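(* Let $\phi$ be a cuspidal cross-cap obtained by folding a cuspidal edge, $$\phi(x,y)=\Big(x,\ a(x)+\tfrac{y^2}{2},\ \big(b_0(x)+b_1(x)y^2+b_2(x)y^3+b_3(x,y)y^4\big)^2\Big),$$ where $a,b_0,b_1,b_2,b_3$ are smooth function germs with $a(0)=a'(0)=b_0(0)=0$ and $b_0'(0)b_2(0)\ne0$. Let $\Sigma$ be the cuspidal edge curve $x\mapsto\phi(x,0)$. For $\mathbf v=(v_1,v_2,v_3)\in S^2$ with $v_1=0$ (so that $\pi_{\mathbf v}$ contains the tangent direction of $\Sigma$ at the origin), the height function along the cuspidal edge curve, $x\mapsto H_{\mathbf v}(x,0)=\phi(x,0)\cdot\mathbf v$, can have an $A_1^{\pm}$ or an $A_2$-singularity at $0$; these are modeled by the submersions $v\pm u^k$, $k=2,3$ respectively, composed with the parametrisation $(x,y)\mapsto(x,y^2,xy^3)=(u,v,w)$ of the model cuspidal cross-cap along its cuspidal edge $y=0$. The conditions for these singularities are: $A_1^{\pm}$: $\pi_{\mathbf v}$ is not the osculating plane of $\Sigma$ at the origin; $A_2$: $\pi_{\mathbf v}$ is the osculating plane of $\Sigma$ at the origin, and $\tau_\Sigma(0)\ne0$.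
   Context: $\pi_{\mathbf v}$ is the plane through the origin orthogonal to $\mathbf v$. $\Sigma$ is a regular space curve with nonzero curvature at the origin; $\tau_\Sigma(0)$ is its torsion there, and its osculating plane at the origin is the plane orthogonal to $(0,-2b_0'(0)^2,a''(0))$. A function germ $(\mathbb R,0)\to(\mathbb R,0)$ has an $A_1^\pm$-singularity (resp. an $A_2$-singularity) at $0$ if it is equivalent, by a diffeomorphism germ of the source, to $\pm x^2$ (resp. $x^3$). *)

theory Defs
  imports "HOL-Analysis.Analysis"
begin

(* Used for open S in Euclidean spaces, where it is the usual class C^k: f is C^(k+1) iff it is
   differentiable with all directional derivatives of class C^k. *)
primrec C_diff_on :: "nat \<Rightarrow> 'a::real_normed_vector set \<Rightarrow> ('a \<Rightarrow> 'b::real_normed_vector) \<Rightarrow> bool" where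
  "C_diff_on 0 S f \<longleftrightarrow> continuous_on S f"
| "C_diff_on (Suc k) S f \<longleftrightarrow>
     (\<forall>x\<in>S. f differentiable (at x)) \<and> (\<forall>v. C_diff_on k S (\<lambda>x. frechet_derivative f (at x) v))"

definition smooth_on :: "'a::real_normed_vector set \<Rightarrow> ('a \<Rightarrow> 'b::real_normed_vector) \<Rightarrow> bool" where
  "smooth_on S f \<longleftrightarrow> (\<forall>k. C_diff_on k S f)"

(* Germs at a point are represented by total functions, of which only the restriction
   to some neighbourhood of the point matters. *)
definition smooth_germ :: "'a::real_normed_vector \<Rightarrow> ('a \<Rightarrow> 'b::real_normed_vector) \<Rightarrow> bool" where
  "smooth_germ p f \<longleftrightarrow> (\<exists>U. open U \<and> p \<in> U \<and> smooth_on U f)"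

definition submersion_germ :: "'a::real_normed_vector \<Rightarrow> ('a \<Rightarrow> 'b::real_normed_vector) \<Rightarrow> bool" where
  "submersion_germ p f \<longleftrightarrow> smooth_germ p f \<and> surj (frechet_derivative f (at p))"

definition diffeo_germ :: "('a::real_normed_vector \<Rightarrow> 'a) \<Rightarrow> 'a \<Rightarrow> 'a \<Rightarrow> bool" where
  "diffeo_germ h p q \<longleftrightarrow> h p = q \<and>
     (\<exists>U V k. open U \<and> open V \<and> p \<in> U \<and> homeomorphism U V h k \<and> smooth_on U h \<and> smooth_on V k)"

definition right_equivalent :: "(real \<Rightarrow> real) \<Rightarrow> (real \<Rightarrow> real) \<Rightarrow> bool" where
  "right_equivalent f g \<longleftrightarrow> (\<exists>h. diffeo_germ h 0 0 \<and> (\<forall>\<^sub>F x in nhds 0. f (h x) = g x))"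

definition A1_plus :: "(real \<Rightarrow> real) \<Rightarrow> bool" where
  "A1_plus f \<longleftrightarrow> right_equivalent f (\<lambda>x. x ^ 2)"

definition A1_minus :: "(real \<Rightarrow> real) \<Rightarrow> bool" where
  "A1_minus f \<longleftrightarrow> right_equivalent f (\<lambda>x. - (x ^ 2))"

definition A2 :: "(real \<Rightarrow> real) \<Rightarrow> bool" where
  "A2 f \<longleftrightarrow> right_equivalent f (\<lambda>x. x ^ 3)"

(* A-equivalence of map germs (R^2,0) -> (R^3,0) *)
definition A_equivalent :: "(real \<times> real \<Rightarrow> real^3) \<Rightarrow> (real \<times> real \<Rightarrow> real^3) \<Rightarrow> bool" where
  "A_equivalent f g \<longleftrightarrow>
     (\<exists>h K. diffeo_germ h 0 0 \<and> diffeo_germ K 0 0 \<and> (\<forall>\<^sub>F p in nhds 0. K (f (h p)) = g p))"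

definition model_cuspidal_edge :: "real \<times> real \<Rightarrow> real^3" where
  "model_cuspidal_edge = (\<lambda>(x, y). vector [x, y ^ 2, y ^ 3])"

definition model_cross_cap :: "real \<times> real \<Rightarrow> real^3" where
  "model_cross_cap = (\<lambda>(x, y). vector [x, y ^ 2, x * y ^ 3])"

(* the function v + s u^k in the coordinates (u,v,w) of R^3 *)
definition model_submersion :: "real \<Rightarrow> nat \<Rightarrow> real^3 \<Rightarrow> real" where
  "model_submersion s k p = p $ 2 + s * (p $ 1) ^ k"

definition cuspidal_edge :: "(real \<times> real \<Rightarrow> real^3) \<Rightarrow> bool" where
  "cuspidal_edge f \<longleftrightarrow> A_equivalent f model_cuspidal_edge"

definition cuspidal_cross_cap :: "(real \<times> real \<Rightarrow> real^3) \<Rightarrow> bool" where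
  "cuspidal_cross_cap f \<longleftrightarrow> A_equivalent f model_cross_cap"

definition fold_map :: "real^3 \<Rightarrow> real^3" where
  "fold_map p = vector [p $ 1, p $ 2, (p $ 3) ^ 2]"

definition edge_param ::
  "(real \<Rightarrow> real) \<Rightarrow> (real \<Rightarrow> real) \<Rightarrow> (real \<Rightarrow> real) \<Rightarrow> (real \<Rightarrow> real) \<Rightarrow> (real \<times> real \<Rightarrow> real)
     \<Rightarrow> real \<times> real \<Rightarrow> real^3" where
  "edge_param a b0 b1 b2 b3 = (\<lambda>(x, y).
     vector [x, a x + y ^ 2 / 2, b0 x + b1 x * y ^ 2 + b2 x * y ^ 3 + b3 (x, y) * y ^ 4])"

definition folded_param ::
  "(real \<Rightarrow> real) \<Rightarrow> (real \<Rightarrow> real) \<Rightarrow> (real \<Rightarrow> real) \<Rightarrow> (real \<Rightarrow> real) \<Rightarrow> (real \<times> real \<Rightarrow> real)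
     \<Rightarrow> real \<times> real \<Rightarrow> real^3" where
  "folded_param a b0 b1 b2 b3 = fold_map \<circ> edge_param a b0 b1 b2 b3"

(* The last two conjuncts follow from the others (b2(0) \<noteq> 0 gives a cuspidal edge and
   b0'(0) b2(0) \<noteq> 0 a cuspidal cross-cap); they are kept to name the objects concerned. *)
definition folded_cuspidal_edge ::
  "(real \<Rightarrow> real) \<Rightarrow> (real \<Rightarrow> real) \<Rightarrow> (real \<Rightarrow> real) \<Rightarrow> (real \<Rightarrow> real) \<Rightarrow> (real \<times> real \<Rightarrow> real) \<Rightarrow> bool"
  where
  "folded_cuspidal_edge a b0 b1 b2 b3 \<longleftrightarrow>
     smooth_germ 0 a \<and> smooth_germ 0 b0 \<and> smooth_germ 0 b1 \<and> smooth_germ 0 b2 \<and> smooth_germ 0 b3 \<and>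
     a 0 = 0 \<and> deriv a 0 = 0 \<and> b0 0 = 0 \<and> deriv b0 0 * b2 0 \<noteq> 0 \<and>
     cuspidal_edge (edge_param a b0 b1 b2 b3) \<and>
     cuspidal_cross_cap (folded_param a b0 b1 b2 b3)"

definition height :: "(real \<times> real \<Rightarrow> real^3) \<Rightarrow> real^3 \<Rightarrow> real \<times> real \<Rightarrow> real" where
  "height f v p = f p \<bullet> v"

definition orth_plane :: "real^3 \<Rightarrow> (real^3) set" where
  "orth_plane v = {p. p \<bullet> v = 0}"

definition curve_deriv :: "nat \<Rightarrow> (real \<Rightarrow> real^3) \<Rightarrow> real \<Rightarrow> real^3" where
  "curve_deriv n c = ((\<lambda>g t. vector_derivative g (at t)) ^^ n) c"

definition osculating_plane :: "(real \<Rightarrow> real^3) \<Rightarrow> real \<Rightarrow> (real^3) set" where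
  "osculating_plane c t = (+) (c t) ` span {curve_deriv 1 c t, curve_deriv 2 c t}"

definition torsion :: "(real \<Rightarrow> real^3) \<Rightarrow> real \<Rightarrow> real" where
  "torsion c t =
     (cross3 (curve_deriv 1 c t) (curve_deriv 2 c t) \<bullet> curve_deriv 3 c t)
       / (norm (cross3 (curve_deriv 1 c t) (curve_deriv 2 c t))) ^ 2"

end

theory Submission
  imports Defs
begin

text \<open>
  The statement is about the height function \<open>H(x) = \<Sigma>(x) \<bullet> v\<close> of the space curve \<open>\<Sigma> = (x, a, b\<^sub>0\<^sup>2)\<close>.
  Its derivatives at the origin are given by \<open>H\<^sup>(\<^sup>n\<^sup>)(0) = \<Sigma>\<^sup>(\<^sup>n\<^sup>)(0) \<bullet> v\<close>, see \<open>funpow_deriv_inner\<close>. Now \<open>H(0) = 0\<close>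
  because the curve starts at the origin, and \<open>H'(0) = 0\<close> because \<open>v\<close> is normal to the tangent.
  The curvature of \<open>\<Sigma>\<close> at the origin is nonzero since \<open>b\<^sub>0'(0) \<noteq> 0\<close>. Therefore \<open>H''(0) = 0\<close> means that \<open>v\<close> is
  normal to the osculating plane. In that case \<open>v\<close> is proportional to \<open>\<Sigma>'(0) \<times> \<Sigma>''(0)\<close>, and so \<open>H'''(0)\<close> is a nonzero
  multiple of the torsion.

  What remains is to read the singularity type off the Taylor coefficients
  (\<open>right_equivalent_power_iff\<close>): for \<open>s \<noteq> 0\<close> and \<open>n \<ge> 1\<close>, a smooth germ \<open>f\<close> is right equivalent to
  \<open>s x\<^sup>n\<close> if and only if its derivatives of order less than \<open>n\<close> vanish and the \<open>n\<close>-th one is \<open>n! s c\<^sup>n\<close> for some \<open>c \<noteq> 0\<close>. The proof divides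
  \<open>f\<close> by \<open>x\<^sup>n\<close> with repeated use of Hadamard's lemma, and then takes a smooth \<open>n\<close>-th root of the quotient to
  obtain the new coordinate, which is invertible by the inverse function theorem.

  On the edge \<open>y = 0\<close> of the model cuspidal cross-cap, the model submersion \<open>v + s u\<^sup>k\<close> restricts to
  \<open>s x\<^sup>k\<close>; for \<open>k = 3\<close> the sign of \<open>s\<close> does not matter because it can be absorbed in the sign of \<open>c\<close>.
  Finally, all three types occur: there are polynomial folded cuspidal edges
  (\<open>folded_cuspidal_edge_monomial\<close>) whose height function along the edge is any given monomial of
  degree at least 2.
\<close>

section \<open>Calculus of smooth maps\<close>

text \<open>Differentiability and the Frechet derivative at a point depend only on the germ there, so on an
  open set the values on that set decide everything. The derivative of a composite or of an integral
  is usually known by a formula valid on the open set only, and this lemma is what lets such a formula be used.\<close>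
lemma C_diff_on_cong:
  assumes "open S" and "\<And>x. x \<in> S \<Longrightarrow> f x = g x"
  shows "C_diff_on k S f \<longleftrightarrow> C_diff_on k S g"
  using assms(2)
proof (induction k arbitrary: f g)
  case 0
  then show ?case by (simp cong: continuous_on_cong)
next
  case (Suc k)
  have *: "(f has_derivative D) (at x) \<longleftrightarrow> (g has_derivative D) (at x)" if "x \<in> S" for x D
    using has_derivative_transform_within_open[OF _ \<open>open S\<close> that] Suc.prems by metis
  then have d: "f differentiable (at x) \<longleftrightarrow> g differentiable (at x)" if "x \<in> S" for x
    using that by (simp add: differentiable_def)
  have "frechet_derivative f (at x) v = frechet_derivative g (at x) v" if "x \<in> S" for x v
    using * that by (simp add: frechet_derivative_def)
  then have "C_diff_on k S (\<lambda>x. frechet_derivative f (at x) v) \<longleftrightarrow>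
        C_diff_on k S (\<lambda>x. frechet_derivative g (at x) v)" for v
    by (intro Suc.IH) auto
  then show ?case using d by simp
qed

text \<open>Any formula for the derivative may stand in for the one selected by \<^const>\<open>frechet_derivative\<close>.
  This is how closure properties are carried from one order of differentiability to the next.\<close>
lemma C_diff_on_SucI:
  assumes "open S" and "\<And>x. x \<in> S \<Longrightarrow> (f has_derivative D x) (at x)"
    and "\<And>v. C_diff_on k S (\<lambda>x. D x v)"
  shows "C_diff_on (Suc k) S f"
proof -
  have "C_diff_on k S (\<lambda>x. frechet_derivative f (at x) v) \<longleftrightarrow> C_diff_on k S (\<lambda>x. D x v)" for v
    by (intro C_diff_on_cong assms(1)) (metis assms(2) frechet_derivative_at)
  then show ?thesis using assms by (auto simp: differentiable_def)
qed

lemma C_diff_on_SucD: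
  assumes "C_diff_on (Suc k) S f"
  shows "x \<in> S \<Longrightarrow> (f has_derivative frechet_derivative f (at x)) (at x)"
    and "C_diff_on k S (\<lambda>x. frechet_derivative f (at x) v)"
  using assms by (auto simp: frechet_derivative_works)

lemma C_diff_on_le_Suc: "C_diff_on (Suc k) S f \<Longrightarrow> C_diff_on k S f"
proof (induction k arbitrary: f)
  case 0
  then show ?case
    by (auto intro!: continuous_at_imp_continuous_on differentiable_imp_continuous_within)
qed simp

lemma C_diff_on_subset: "C_diff_on k S f \<Longrightarrow> T \<subseteq> S \<Longrightarrow> C_diff_on k T f"
  by (induction k arbitrary: f) (auto intro: continuous_on_subset)

lemma C_diff_on_const: "open S \<Longrightarrow> C_diff_on k S (\<lambda>x. c)"
proof (induction k arbitrary: c)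
  case (Suc k)
  show ?case
    by (rule C_diff_on_SucI[OF Suc.prems, where D = "\<lambda>x v. 0"]) (auto intro: Suc)
qed simp

lemma C_diff_on_bounded_linear:
  assumes "open S" "bounded_linear f" shows "C_diff_on k S f"
proof (cases k)
  case 0
  then show ?thesis using assms by (simp add: linear_continuous_on)
next
  case (Suc j)
  then show ?thesis
    using C_diff_on_SucI[OF \<open>open S\<close>, of f "\<lambda>x. f" j] C_diff_on_const[OF \<open>open S\<close>]
      bounded_linear_imp_has_derivative[OF assms(2)] by metis
qed

lemma C_diff_on_add:
  assumes "open S" "C_diff_on k S f" "C_diff_on k S g"
  shows "C_diff_on k S (\<lambda>x. f x + g x)"
  using assms(2,3)
proof (induction k arbitrary: f g)
  case (Suc k)
  note D = C_diff_on_SucD[OF Suc.prems(1)] C_diff_on_SucD[OF Suc.prems(2)]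
  show ?case
    by (rule C_diff_on_SucI[OF \<open>open S\<close> has_derivative_add[OF D(1) D(3)]])
       (auto intro!: Suc.IH D)
qed (simp add: continuous_on_add)

lemma (in bounded_bilinear) C_diff_on:
  assumes "open S" "C_diff_on k S f" "C_diff_on k S g"
  shows "C_diff_on k S (\<lambda>x. prod (f x) (g x))"
  using assms(2,3)
proof (induction k arbitrary: f g)
  case (Suc k)
  note D = C_diff_on_SucD[OF Suc.prems(1)] C_diff_on_SucD[OF Suc.prems(2)]
  show ?case
    by (rule C_diff_on_SucI[OF \<open>open S\<close> FDERIV[OF D(1) D(3)]])
       (assumption | intro C_diff_on_add \<open>open S\<close> Suc.IH D(2,4) C_diff_on_le_Suc[OF Suc.prems(1)]
          C_diff_on_le_Suc[OF Suc.prems(2)])+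
qed (simp add: continuous_on)

lemma C_diff_on_sum:
  assumes "open S" "\<And>i. i \<in> I \<Longrightarrow> C_diff_on k S (f i)"
  shows "C_diff_on k S (\<lambda>x. \<Sum>i\<in>I. f i x)"
  using assms(2)
  by (induction I rule: infinite_finite_induct)
     (auto intro!: C_diff_on_const C_diff_on_add \<open>open S\<close>)

text \<open>The chain rule produces the derivative of \<open>g\<close> in the direction \<open>f'(x) v\<close>, which moves with \<open>x\<close>,
  whereas the definition speaks of fixed directions only. Expanding this direction in the
  standard basis of the intermediate space turns the derivative of the composite into a finite sum of
  products of functions already known to be of class \<open>C\<^sup>k\<close>.\<close>
lemma C_diff_on_compose:
  fixes f :: "'a::real_normed_vector \<Rightarrow> 'b::euclidean_space" and g :: "'b \<Rightarrow> 'c::real_normed_vector"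
  assumes "open S" "C_diff_on k S f" "C_diff_on k T g" "f ` S \<subseteq> T"
  shows "C_diff_on k S (\<lambda>x. g (f x))"
  using assms(2,3)
proof (induction k arbitrary: g)
  case 0
  then show ?case using assms(4) by (auto intro!: continuous_on_compose2[of T g S f])
next
  case (Suc k)
  note F = C_diff_on_SucD[OF Suc.prems(1)] and G = C_diff_on_SucD[OF Suc.prems(2)]
  show ?case
  proof (rule C_diff_on_SucI[OF \<open>open S\<close>, where D = "\<lambda>x v. \<Sum>b\<in>Basis.
        (frechet_derivative f (at x) v \<bullet> b) *\<^sub>R frechet_derivative g (at (f x)) b"])
    fix x assume "x \<in> S"
    then have x: "f x \<in> T" using assms(4) by auto
    have lin: "linear (frechet_derivative g (at (f x)))"
      using G(1)[OF x] has_derivative_linear by blast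
    have expand: "frechet_derivative g (at (f x)) w =
        (\<Sum>b\<in>Basis. (w \<bullet> b) *\<^sub>R frechet_derivative g (at (f x)) b)" for w
      by (subst euclidean_representation[of w, symmetric])
         (simp only: linear_sum[OF lin] linear_cmul[OF lin])
    show "((\<lambda>x. g (f x)) has_derivative (\<lambda>v. \<Sum>b\<in>Basis.
        (frechet_derivative f (at x) v \<bullet> b) *\<^sub>R frechet_derivative g (at (f x)) b)) (at x)"
      by (rule has_derivative_eq_rhs[OF has_derivative_compose[OF F(1)[OF \<open>x \<in> S\<close>] G(1)[OF x]]])
         (rule ext, rule expand)
  next
    fix v
    show "C_diff_on k S (\<lambda>x. \<Sum>b\<in>Basis.
        (frechet_derivative f (at x) v \<bullet> b) *\<^sub>R frechet_derivative g (at (f x)) b)"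
      by (intro C_diff_on_sum bounded_bilinear.C_diff_on[OF bounded_bilinear_scaleR]
          bounded_bilinear.C_diff_on[OF bounded_bilinear_inner] C_diff_on_const \<open>open S\<close> F(2)
          Suc.IH[OF C_diff_on_le_Suc[OF Suc.prems(1)] G(2)])
  qed
qed

lemma smooth_on_bounded_bilinear:
  assumes "bounded_bilinear p" "open S" "smooth_on S f" "smooth_on S g"
  shows "smooth_on S (\<lambda>x. p (f x) (g x))"
  using bounded_bilinear.C_diff_on[OF assms(1,2)] assms(3,4) by (simp add: smooth_on_def)

lemmas smooth_on_mult = smooth_on_bounded_bilinear[OF bounded_bilinear_mult]
  and smooth_on_scaleR = smooth_on_bounded_bilinear[OF bounded_bilinear_scaleR]

lemma smooth_on_const: "open S \<Longrightarrow> smooth_on S (\<lambda>x. c)"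
  by (simp add: smooth_on_def C_diff_on_const)

lemma smooth_on_bounded_linear: "open S \<Longrightarrow> bounded_linear f \<Longrightarrow> smooth_on S f"
  by (simp add: smooth_on_def C_diff_on_bounded_linear)

lemma smooth_on_ident: "open S \<Longrightarrow> smooth_on S (\<lambda>x. x)"
  by (rule smooth_on_bounded_linear[OF _ bounded_linear_ident])

lemma smooth_on_add: "open S \<Longrightarrow> smooth_on S f \<Longrightarrow> smooth_on S g \<Longrightarrow> smooth_on S (\<lambda>x. f x + g x)"
  by (simp add: smooth_on_def C_diff_on_add)

lemma smooth_on_sum:
  "open S \<Longrightarrow> (\<And>i. i \<in> I \<Longrightarrow> smooth_on S (f i)) \<Longrightarrow> smooth_on S (\<lambda>x. \<Sum>i\<in>I. f i x)"
  by (simp add: smooth_on_def C_diff_on_sum)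

lemma smooth_on_diff:
  "open S \<Longrightarrow> smooth_on S f \<Longrightarrow> smooth_on S g \<Longrightarrow> smooth_on S (\<lambda>x. f x - g x)"
  using smooth_on_add[of S f "\<lambda>x. -1 *\<^sub>R g x"] smooth_on_scaleR[of S "\<lambda>x. -1" g]
  by (simp add: smooth_on_const)

lemma smooth_on_power:
  fixes f :: "'a::real_normed_vector \<Rightarrow> 'b::real_normed_algebra_1"
  shows "open S \<Longrightarrow> smooth_on S f \<Longrightarrow> smooth_on S (\<lambda>x. f x ^ n)"
  by (induction n) (auto intro: smooth_on_mult smooth_on_const)

lemma smooth_on_compose:
  fixes f :: "'a::real_normed_vector \<Rightarrow> 'b::euclidean_space"
  shows "open S \<Longrightarrow> smooth_on S f \<Longrightarrow> smooth_on T g \<Longrightarrow> f ` S \<subseteq> T \<Longrightarrow> smooth_on S (\<lambda>x. g (f x))"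
  unfolding smooth_on_def using C_diff_on_compose by blast

lemma smooth_on_subset: "smooth_on S f \<Longrightarrow> T \<subseteq> S \<Longrightarrow> smooth_on T f"
  unfolding smooth_on_def using C_diff_on_subset by blast

lemma smooth_on_nth:
  fixes f :: "'a::real_normed_vector \<Rightarrow> real^'n"
  assumes "open S" "smooth_on S f" shows "smooth_on S (\<lambda>x. f x $ i)"
  using smooth_on_compose[OF assms smooth_on_bounded_linear[OF open_UNIV bounded_linear_vec_nth]]
  by simp

lemma smooth_on_vec:
  fixes f :: "'a::real_normed_vector \<Rightarrow> real^'n"
  assumes "open S" "\<And>i. smooth_on S (\<lambda>x. f x $ i)"
  shows "smooth_on S f"
proof -
  have "smooth_on S (\<lambda>x. \<Sum>i\<in>UNIV. (f x $ i) *\<^sub>R (axis i 1 :: real^'n))"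
    by (intro smooth_on_sum smooth_on_scaleR smooth_on_const assms)
  moreover have "(\<Sum>i\<in>UNIV. (f x $ i) *\<^sub>R (axis i 1 :: real^'n)) = f x" for x
    by (simp add: vec_eq_iff axis_def if_distrib cong: if_cong)
  ultimately show ?thesis by simp
qed

lemma smooth_on_vector_3:
  assumes "open S" "smooth_on S f" "smooth_on S g" "smooth_on S h"
  shows "smooth_on S (\<lambda>x. vector [f x, g x, h x] :: real^3)"
proof (rule smooth_on_vec[OF assms(1)])
  fix i :: 3
  show "smooth_on S (\<lambda>x. (vector [f x, g x, h x] :: real^3) $ i)"
    using exhaust_3[of i] assms by (auto simp: vector_3)
qed

lemma C_diff_on_SucI_real:
  fixes f :: "real \<Rightarrow> real"
  assumes "open S" "\<And>x. x \<in> S \<Longrightarrow> (f has_real_derivative f' x) (at x)" "C_diff_on k S f'"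
  shows "C_diff_on (Suc k) S f"
  by (rule C_diff_on_SucI[OF assms(1) assms(2)[unfolded has_field_derivative_def]])
     (auto intro!: bounded_bilinear.C_diff_on[OF bounded_bilinear_mult] assms C_diff_on_const)

lemma smooth_on_imp_differentiable:
  "smooth_on S f \<Longrightarrow> x \<in> S \<Longrightarrow> (f has_derivative frechet_derivative f (at x)) (at x)"
  unfolding smooth_on_def using C_diff_on_SucD(1) by blast

lemma smooth_on_real_deriv:
  fixes f :: "real \<Rightarrow> real"
  assumes "open S" "smooth_on S f"
  shows "x \<in> S \<Longrightarrow> (f has_real_derivative deriv f x) (at x)" and "smooth_on S (deriv f)"
proof -
  have d: "(f has_real_derivative deriv f x) (at x)" if "x \<in> S" for x
    using smooth_on_imp_differentiable[OF assms(2) that]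
    by (metis DERIV_deriv_iff_real_differentiable differentiable_def)
  then show "x \<in> S \<Longrightarrow> (f has_real_derivative deriv f x) (at x)" .
  have "frechet_derivative f (at x) 1 = deriv f x" if "x \<in> S" for x
    using frechet_derivative_at[OF d[OF that, unfolded has_field_derivative_def], symmetric] by simp
  moreover have "smooth_on S (\<lambda>x. frechet_derivative f (at x) 1)"
    using assms(2) C_diff_on_SucD(2)[of _ S f 1] unfolding smooth_on_def by blast
  ultimately show "smooth_on S (deriv f)"
    using C_diff_on_cong[OF assms(1), of "\<lambda>x. frechet_derivative f (at x) 1" "deriv f"]
    by (simp add: smooth_on_def)
qed

lemma smooth_on_funpow_deriv:
  fixes f :: "real \<Rightarrow> real"
  shows "open S \<Longrightarrow> smooth_on S f \<Longrightarrow> smooth_on S ((deriv ^^ n) f)"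
  by (induction n) (auto intro: smooth_on_real_deriv)

text \<open>One family that is closed under differentiation, up to constant factors, covers square roots, cube
  roots and reciprocals.\<close>
lemma smooth_on_powr: "smooth_on {0<..} (\<lambda>x::real. x powr a)"
proof -
  have "C_diff_on k {0<..} (\<lambda>x::real. c * x powr a)" for k c
  proof (induction k arbitrary: c a)
    case (Suc k)
    show ?case
      by (rule C_diff_on_SucI_real[where f' = "\<lambda>x. (c * a) * x powr (a - 1)", OF _ _ Suc])
         (auto intro!: derivative_eq_intros)
  qed (auto intro!: continuous_intros)
  from this[of _ 1] show ?thesis by (simp add: smooth_on_def)
qed

section \<open>Division of smooth functions by powers of the variable\<close>

lemma smooth_germ_ball:
  assumes "smooth_germ 0 f" obtains r where "r > 0" "smooth_on (ball 0 r) f"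
proof -
  obtain U where "open U" "0 \<in> U" "smooth_on U f" using assms by (auto simp: smooth_germ_def)
  then show thesis using that open_contains_ball smooth_on_subset by metis
qed

lemma scaled_in_ball:
  fixes x :: real
  assumes "x \<in> ball 0 r" "t \<in> {0..1}" shows "t * x \<in> ball 0 r"
proof -
  have "\<bar>t * x\<bar> \<le> 1 * \<bar>x\<bar>" unfolding abs_mult using assms(2) by (intro mult_right_mono) auto
  then show ?thesis using assms(1) by simp
qed

text \<open>Differentiating \<open>\<integral> t\<^sup>m G(t x) dt\<close> under the integral sign gives \<open>\<integral> t\<^sup>m\<^sup>+\<^sup>1 G'(t x) dt\<close>, an integral of the
  same shape. The weights \<open>t\<^sup>m\<close> are there to make the family closed under differentiation.\<close>
lemma smooth_on_scaling_integral:
  fixes F :: "real \<Rightarrow> real"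
  assumes "smooth_on (ball 0 r) F"
  shows "smooth_on (ball 0 r) (\<lambda>x. integral {0..1} (\<lambda>t. F (t * x)))"
proof -
  have D: "((\<lambda>x. integral {0..1} (\<lambda>t. t ^ m * G (t * x))) has_real_derivative
            integral {0..1} (\<lambda>t. t ^ Suc m * deriv G (t * x))) (at x)"
    if G: "smooth_on (ball 0 r) G" and x: "x \<in> ball 0 r" for G :: "real \<Rightarrow> real" and m x
  proof -
    note G' = smooth_on_real_deriv[OF open_ball G]
    have contG: "continuous_on (ball 0 r) G" and contG': "continuous_on (ball 0 r) (deriv G)"
      using G G'(2) unfolding smooth_on_def by (metis C_diff_on.simps(1))+
    have "((\<lambda>x. integral (cbox 0 1) (\<lambda>t. t ^ m * G (t * x))) has_real_derivative
            integral (cbox 0 1) (\<lambda>t. t ^ Suc m * deriv G (t * x))) (at x within ball 0 r)"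
    proof (rule leibniz_rule_field_derivative)
      fix y t :: real assume "y \<in> ball 0 r" "t \<in> cbox 0 1"
      then have "(G has_real_derivative deriv G (t * y)) (at (t * y))"
        using G'(1)[OF scaled_in_ball] by simp
      then have "((\<lambda>y. G (t * y)) has_real_derivative deriv G (t * y) * t) (at y within ball 0 r)"
        by (rule DERIV_chain2) (auto intro!: derivative_eq_intros)
      then show "((\<lambda>y. t ^ m * G (t * y)) has_real_derivative t ^ Suc m * deriv G (t * y)) (at y within ball 0 r)"
        by (auto intro!: derivative_eq_intros)
    next
      fix y :: real assume "y \<in> ball 0 r"
      then show "(\<lambda>t. t ^ m * G (t * y)) integrable_on cbox 0 1"
        by (intro integrable_continuous continuous_intros continuous_on_compose2[OF contG])
           (use scaled_in_ball in auto)
    next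
      show "continuous_on (ball 0 r \<times> cbox 0 1) (\<lambda>(x, t). t ^ Suc m * deriv G (t * x))"
        unfolding split_beta
        by (intro continuous_intros continuous_on_compose2[OF contG'])
           (use scaled_in_ball in auto)
    qed (use x in auto)
    then show ?thesis using at_within_open[OF x open_ball] by simp
  qed
  have "C_diff_on k (ball 0 r) (\<lambda>x. integral {0..1} (\<lambda>t. t ^ m * G (t * x)))"
    if "smooth_on (ball 0 r) G" for k m and G :: "real \<Rightarrow> real"
    using that
  proof (induction k arbitrary: m G)
    case 0
    show ?case
      using D[OF 0] by (auto intro!: continuous_at_imp_continuous_on DERIV_isCont)
  next
    case (Suc k)
    show ?case
      using D[OF Suc.prems] Suc.IH[OF smooth_on_real_deriv(2)[OF open_ball Suc.prems]]
      by (intro C_diff_on_SucI_real[OF open_ball])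
  qed
  from this[OF assms, of _ 0] show ?thesis by (simp add: smooth_on_def)
qed

text \<open>Hadamard's lemma: \<open>f(x)\<close> is the integral over \<open>[0, 1]\<close> of the \<open>t\<close>-derivative of \<open>f(t x)\<close>, which is
  \<open>x f'(t x)\<close>. Dividing by \<open>x\<close> in this way loses no smoothness at the origin.\<close>
lemma hadamard:
  fixes f :: "real \<Rightarrow> real"
  assumes "r > 0" "smooth_on (ball 0 r) f" "f 0 = 0"
  obtains q where "smooth_on (ball 0 r) q" "\<And>x. x \<in> ball 0 r \<Longrightarrow> f x = x * q x" "q 0 = deriv f 0"
proof
  note D = smooth_on_real_deriv[OF open_ball assms(2)]
  define q where "q x = integral {0..1} (\<lambda>t. deriv f (t * x))" for x
  show "smooth_on (ball 0 r) q"
    unfolding q_def using smooth_on_scaling_integral[OF D(2)] .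
  show "f x = x * q x" if x: "x \<in> ball 0 r" for x
  proof -
    have "((\<lambda>t. f (t * x)) has_real_derivative x * deriv f (t * x)) (at t within {0..1})"
      if "t \<in> {0..1}" for t
    proof -
      have "((\<lambda>t. f (t * x)) has_real_derivative deriv f (t * x) * x) (at t within {0..1})"
        using D(1)[OF scaled_in_ball[OF x that]]
        by (rule DERIV_chain2) (auto intro!: derivative_eq_intros)
      then show ?thesis by (simp add: mult.commute)
    qed
    then have "((\<lambda>t. x * deriv f (t * x)) has_integral (f (1 * x) - f (0 * x))) {0..1}"
      by (intro fundamental_theorem_of_calculus)
         (auto simp: has_real_derivative_iff_has_vector_derivative)
    then show ?thesis
      using assms(3) by (simp add: q_def integral_unique flip: integral_mult_right)
  qed
  show "q 0 = deriv f 0" by (simp add: q_def)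
qed

text \<open>Differentiating \<open>x\<^sup>n\<^sup>+\<^sup>1 g\<close> gives \<open>x\<^sup>n ((n + 1) g + x g')\<close>, again a power times a smooth function, and the
  new cofactor has the value \<open>(n + 1) g(0)\<close> at the origin.\<close>
lemma derivs_of_power_multiple:
  fixes f g :: "real \<Rightarrow> real"
  assumes "r > 0" "smooth_on (ball 0 r) g" "\<And>x. x \<in> ball 0 r \<Longrightarrow> f x = x ^ n * g x"
  shows "(\<forall>j<n. (deriv ^^ j) f 0 = 0) \<and> (deriv ^^ n) f 0 = fact n * g 0"
  using assms(2,3)
proof (induction n arbitrary: f g)
  case 0
  then show ?case using assms(1) by simp
next
  case (Suc n)
  note D = smooth_on_real_deriv[OF open_ball Suc.prems(1)]
  define h where "h = (\<lambda>x. real (Suc n) * g x + x * deriv g x)"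
  have h: "smooth_on (ball 0 r) h"
    unfolding h_def
    by (intro smooth_on_add smooth_on_mult smooth_on_const smooth_on_ident D(2) Suc.prems open_ball)
  have "deriv f x = x ^ n * h x" if x: "x \<in> ball 0 r" for x
  proof (rule DERIV_imp_deriv)
    have "((\<lambda>x. x ^ Suc n * g x) has_real_derivative x ^ n * h x) (at x)"
      using DERIV_mult[OF DERIV_pow[of "Suc n" x UNIV] D(1)[OF x]]
      by (simp add: h_def algebra_simps)
    then show "(f has_real_derivative x ^ n * h x) (at x)"
      by (rule has_field_derivative_transform_within_open[OF _ open_ball x]) (simp add: Suc.prems(2))
  qed
  from Suc.IH[OF h this]
  have IH: "\<forall>j<n. (deriv ^^ Suc j) f 0 = 0" "(deriv ^^ Suc n) f 0 = fact n * h 0"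
    by (auto simp: funpow_Suc_right simp del: funpow.simps)
  have "f 0 = 0" using Suc.prems(2)[of 0] assms(1) by simp
  then have "(deriv ^^ j) f 0 = 0" if "j < Suc n" for j
    using IH(1) that by (cases j) auto
  moreover have "fact n * h 0 = fact (Suc n) * g 0" by (simp add: h_def algebra_simps)
  ultimately show ?case using IH(2) by metis
qed

text \<open>As long as the next derivative of \<open>f\<close> vanishes, so does the cofactor at the origin, and Hadamard's
  lemma splits off one more factor \<open>x\<close>.\<close>
lemma power_multiple_if_derivs_vanish:
  fixes f :: "real \<Rightarrow> real"
  assumes "r > 0" "smooth_on (ball 0 r) f" "\<forall>j<n. (deriv ^^ j) f 0 = 0"
  obtains g where "smooth_on (ball 0 r) g" "\<And>x. x \<in> ball 0 r \<Longrightarrow> f x = x ^ n * g x"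
    "(deriv ^^ n) f 0 = fact n * g 0"
proof -
  have "\<exists>g. smooth_on (ball 0 r) g \<and> (\<forall>x\<in>ball 0 r. f x = x ^ n * g x)"
    using assms(3)
  proof (induction n)
    case 0
    then show ?case using assms(2) by auto
  next
    case (Suc n)
    then obtain g where g: "smooth_on (ball 0 r) g" "\<And>x. x \<in> ball 0 r \<Longrightarrow> f x = x ^ n * g x"
      by auto
    then have "(deriv ^^ n) f 0 = fact n * g 0"
      using derivs_of_power_multiple assms(1) by blast
    then have "g 0 = 0" using Suc.prems by simp
    then obtain q where "smooth_on (ball 0 r) q" "\<And>x. x \<in> ball 0 r \<Longrightarrow> g x = x * q x"
      using hadamard[OF assms(1) g(1)] by metis
    then show ?case using g(2) by (intro exI[of _ q]) auto
  qed
  then show thesis using that derivs_of_power_multiple assms(1) by metis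
qed

section \<open>Germs right equivalent to a power\<close>

text \<open>The inverse function theorem supplies a differentiable inverse \<open>g\<close> with \<open>g' = 1 / (f' \<circ> g)\<close>. By this
  equation \<open>g'\<close> is as often differentiable as \<open>g\<close>, so \<open>g\<close> is smooth.\<close>
lemma real_inverse_function_smooth:
  fixes f :: "real \<Rightarrow> real"
  assumes "open S" "x0 \<in> S" "smooth_on S f" "deriv f x0 \<noteq> 0"
  obtains U V g where "open U" "open V" "U \<subseteq> S" "x0 \<in> U" "homeomorphism U V f g"
    "smooth_on U f" "smooth_on V g"
proof -
  note D = smooth_on_real_deriv[OF assms(1,3)]
  have cont: "continuous_on S (deriv f)"
    using D(2) unfolding smooth_on_def by (metis C_diff_on.simps(1))
  define T where "T = S \<inter> deriv f -` (- {0})"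
  have T: "open T" "x0 \<in> T" "T \<subseteq> S"
    using continuous_open_preimage[OF cont assms(1)] assms by (auto simp: T_def)
  obtain U V g g' where *: "open U" "U \<subseteq> T" "x0 \<in> U" "open V" "homeomorphism U V f g"
      and g: "\<And>y. y \<in> V \<Longrightarrow> (g has_derivative g' y) (at y)"
      and g': "\<And>y. y \<in> V \<Longrightarrow> g' y = inv (blinfun_apply (blinfun_mult_right (deriv f (g y))))"
  proof (rule inverse_function_theorem)
    show "(f has_derivative blinfun_apply (blinfun_mult_right (deriv f x))) (at x)" if "x \<in> T" for x
      using D(1) T(3) that by (auto simp: has_field_derivative_def)
    show "continuous_on T (\<lambda>x. blinfun_mult_right (deriv f x))"
      by (intro bounded_linear.continuous_on[OF bounded_linear_blinfun_mult_right]
          continuous_on_subset[OF cont T(3)])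
    show "blinfun_mult_right (inverse (deriv f x0)) o\<^sub>L blinfun_mult_right (deriv f x0) = id_blinfun"
      using assms(4) by (intro blinfun_eqI) simp
  qed (use T in auto)
  have inT: "g y \<in> T" if "y \<in> V" for y
    using *(2,5) that by (auto simp: homeomorphism_def)
  have Dg: "(g has_real_derivative inverse (deriv f (g y))) (at y)" if "y \<in> V" for y
  proof -
    have "deriv f (g y) \<noteq> 0" using inT[OF that] by (simp add: T_def)
    then have "inv (\<lambda>h. deriv f (g y) * h) = (\<lambda>h. inverse (deriv f (g y)) * h)"
      by (intro inv_unique_comp) (auto simp: fun_eq_iff)
    then show ?thesis
      using g[OF that] g'[OF that] by (simp add: has_field_derivative_def)
  qed
  have inv_smooth: "smooth_on T (\<lambda>x. inverse (deriv f x))"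
  proof -
    \<comment> \<open>The derivative may be negative, where real powers are of no use, so \<open>1 / f'\<close> is written as
      \<open>f' \<cdot> (f'\<^sup>2)\<^sup>-\<^sup>1\<close>.\<close>
    have "smooth_on T (\<lambda>x. deriv f x * (deriv f x ^ 2) powr (-1))"
      by (intro smooth_on_mult \<open>open T\<close> smooth_on_subset[OF D(2) T(3)]
          smooth_on_compose[OF _ _ smooth_on_powr] smooth_on_power) (auto simp: T_def)
    moreover have "deriv f x * (deriv f x ^ 2) powr (-1) = inverse (deriv f x)" if "x \<in> T" for x
      using that by (auto simp: T_def powr_minus power2_eq_square)
    ultimately show ?thesis
      using C_diff_on_cong[OF \<open>open T\<close>] unfolding smooth_on_def by (metis (no_types, lifting))
  qed
  have "C_diff_on k V g" for k
  proof (induction k)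
    case 0
    show ?case using *(5) by (simp add: homeomorphism_def)
  next
    case (Suc k)
    have "C_diff_on k V (\<lambda>y. inverse (deriv f (g y)))"
      using C_diff_on_compose[OF \<open>open V\<close> Suc] inv_smooth inT
      unfolding smooth_on_def by blast
    then show ?case using C_diff_on_SucI_real[OF \<open>open V\<close> Dg] by simp
  qed
  then show thesis
    using that[OF *(1,4) _ *(3,5)] *(2) T(3) smooth_on_subset[OF assms(3)]
    by (auto simp: smooth_on_def)
qed

text \<open>The germs right equivalent to \<open>s x\<^sup>n\<close> are the \<open>s k(x)\<^sup>n\<close> with \<open>k\<close> a diffeomorphism germ. Writing
  \<open>k(x) = x q(x)\<close> by Hadamard's lemma shows that these are exactly the \<open>x\<^sup>n g(x)\<close> with
  \<open>g(0) = s c\<^sup>n\<close>, \<open>c \<noteq> 0\<close>: conversely, for such \<open>g\<close> the quotient \<open>g / s\<close> has a smooth \<open>n\<close>-th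
  root near the origin, with value \<open>c\<close> there. By Taylor expansion the condition on \<open>g\<close> is one on the
  derivatives of \<open>f\<close>.
  Stating it with \<open>c\<close> treats odd \<open>n\<close>, for which every sign is allowed, and even \<open>n\<close> alike.\<close>
lemma right_equivalent_power_iff:
  fixes f :: "real \<Rightarrow> real"
  assumes "smooth_germ 0 f" "s \<noteq> 0" "n > 0"
  shows "right_equivalent f (\<lambda>x. s * x ^ n) \<longleftrightarrow>
    (\<forall>j<n. (deriv ^^ j) f 0 = 0) \<and> (\<exists>c. c \<noteq> 0 \<and> (deriv ^^ n) f 0 = fact n * (s * c ^ n))"
    (is "?L \<longleftrightarrow> ?R")
proof
  assume ?L
  then obtain h U V k where h: "h 0 = 0" "open U" "open V" "0 \<in> U" "homeomorphism U V h k"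
      "smooth_on U h" "smooth_on V k" and fh: "\<forall>\<^sub>F x in nhds 0. f (h x) = s * x ^ n"
    unfolding right_equivalent_def diffeo_germ_def by blast
  have V0: "0 \<in> V" and k0: "k 0 = 0" and kh: "\<And>x. x \<in> U \<Longrightarrow> k (h x) = x" and hk: "\<And>y. y \<in> V \<Longrightarrow> h (k y) = y"
    using h(1,4,5) by (auto simp: homeomorphism_def image_iff) 
  have "isCont k 0"
    using h(3,5) V0 by (auto simp: homeomorphism_def continuous_on_eq_continuous_at)
  then have "filterlim k (nhds 0) (nhds 0)"
    using k0 by (metis isCont_def tendsto_at_iff_tendsto_nhds)
  with fh have "\<forall>\<^sub>F y in nhds 0. f (h (k y)) = s * k y ^ n"
    by (rule eventually_compose_filterlim)
  moreover have "\<forall>\<^sub>F y in nhds 0. y \<in> V" using h(3) V0 by (simp add: eventually_nhds_in_open)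
  ultimately have "\<forall>\<^sub>F y in nhds 0. y \<in> V \<and> f y = s * k y ^ n"
    by eventually_elim (simp add: hk)
  then obtain r where r: "r > 0" "\<And>y. y \<in> ball 0 r \<Longrightarrow> y \<in> V \<and> f y = s * k y ^ n"
    by (auto simp: eventually_nhds_metric dist_commute)
  have "ball 0 r \<subseteq> V" using r(2) by blast
  then have ks: "smooth_on (ball 0 r) k" using smooth_on_subset[OF h(7)] by blast
  then obtain q where q: "smooth_on (ball 0 r) q" "\<And>x. x \<in> ball 0 r \<Longrightarrow> k x = x * q x"
      "q 0 = deriv k 0"
    using hadamard[OF r(1) ks k0] by metis
  have "deriv k 0 * deriv h 0 = 1"
  proof -
    have "((\<lambda>x. k (h x)) has_real_derivative deriv k 0 * deriv h 0) (at 0)"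
      using DERIV_chain2[of k _ h 0] smooth_on_real_deriv(1)[OF h(2,6,4)]
        smooth_on_real_deriv(1)[OF h(3,7) V0] h(1) by metis
    moreover have "((\<lambda>x. k (h x)) has_real_derivative 1) (at 0)"
      by (rule has_field_derivative_transform_within_open[OF DERIV_ident h(2,4)]) (simp add: kh)
    ultimately show ?thesis by (rule DERIV_unique)
  qed
  then have "q 0 \<noteq> 0" using q(3) by auto
  have "smooth_on (ball 0 r) (\<lambda>x. s * q x ^ n)"
    by (intro smooth_on_mult smooth_on_const smooth_on_power q(1) open_ball)
  moreover have "f x = x ^ n * (s * q x ^ n)" if "x \<in> ball 0 r" for x
    using r(2)[OF that] q(2)[OF that] by (simp add: power_mult_distrib)
  ultimately have "(\<forall>j<n. (deriv ^^ j) f 0 = 0) \<and> (deriv ^^ n) f 0 = fact n * (s * q 0 ^ n)"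
    by (intro derivs_of_power_multiple[OF r(1)])
  then show ?R using \<open>q 0 \<noteq> 0\<close> by blast
next
  assume ?R
  then obtain c where c: "\<forall>j<n. (deriv ^^ j) f 0 = 0" "c \<noteq> 0"
      "(deriv ^^ n) f 0 = fact n * (s * c ^ n)" by blast
  obtain r where r: "r > 0" "smooth_on (ball 0 r) f" using smooth_germ_ball[OF assms(1)] .
  obtain g where g: "smooth_on (ball 0 r) g" "\<And>x. x \<in> ball 0 r \<Longrightarrow> f x = x ^ n * g x"
      and "(deriv ^^ n) f 0 = fact n * g 0"
    using power_multiple_if_derivs_vanish[OF r c(1)] by blast
  then have g0: "g 0 = s * c ^ n" using c(3) by simp
  then have "g 0 \<noteq> 0" using assms c by simp
  define S where "S = ball 0 r \<inter> (\<lambda>x. g x / g 0) -` {0<..}"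
  have "continuous_on (ball 0 r) g"
    using g(1) unfolding smooth_on_def by (metis C_diff_on.simps(1))
  then have S: "open S" "0 \<in> S" "S \<subseteq> ball 0 r"
    unfolding S_def using r(1) \<open>g 0 \<noteq> 0\<close>
    by (auto intro!: continuous_open_preimage continuous_intros)
  \<comment> \<open>The root is taken of \<open>g / g(0)\<close>, which is positive near the origin whatever the sign of \<open>g(0)\<close>; the
    factor \<open>c\<close> restores the constant because \<open>s c\<^sup>n = g(0)\<close>.\<close>
  define m where "m x = c * (g x / g 0) powr (1 / n)" for x
  have m: "smooth_on S m"
    unfolding m_def divide_inverse
    by (intro smooth_on_mult smooth_on_const smooth_on_compose[OF _ _ smooth_on_powr] S(1)
        smooth_on_subset[OF g(1) S(3)]) (auto simp: S_def field_simps)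
  define k where "k x = x * m x" for x
  have k: "smooth_on S k"
    unfolding k_def by (intro smooth_on_mult smooth_on_ident m S(1))
  have fk: "f x = s * k x ^ n" if "x \<in> S" for x
  proof -
    have "g x / g 0 > 0" using that by (simp add: S_def)
    moreover have "(y powr (1 / n)) ^ n = y" if "y > 0" for y :: real
      using assms(3) that by (simp add: powr_power)
    ultimately have "((g x / g 0) powr (1 / n)) ^ n = g x / g 0" by blast
    then have "s * k x ^ n = x ^ n * (s * c ^ n * (g x / g 0))"
      by (simp add: k_def m_def power_mult_distrib)
    also have "\<dots> = f x" using g0 \<open>g 0 \<noteq> 0\<close> g(2) S(3) that by auto
    finally show ?thesis by simp
  qed
  have "deriv k 0 = m 0"
    unfolding k_def
    by (rule DERIV_imp_deriv)
       (use smooth_on_real_deriv(1)[OF S(1) m S(2)] in \<open>auto intro!: derivative_eq_intros\<close>)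
  then have "deriv k 0 \<noteq> 0" using c(2) \<open>g 0 \<noteq> 0\<close> by (simp add: m_def)
  then obtain U V h where h: "open U" "open V" "U \<subseteq> S" "0 \<in> U" "homeomorphism U V k h"
      "smooth_on U k" "smooth_on V h"
    using real_inverse_function_smooth[OF S(1,2) k] by metis
  have hV: "h y \<in> U" "k (h y) = y" if "y \<in> V" for y
    using h(5) that by (auto simp: homeomorphism_def)
  have V0: "0 \<in> V" and h0: "h 0 = 0"
    using h(4,5) k_def[of 0] by (auto simp: homeomorphism_def image_iff)
  have "diffeo_germ h 0 0"
    unfolding diffeo_germ_def
    using h(1,2,6,7) homeomorphism_symD[OF h(5)] V0 h0 by blast
  moreover have "f (h y) = s * y ^ n" if "y \<in> V" for y
    using fk[of "h y"] hV[OF that] h(3) by auto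
  then have "\<forall>\<^sub>F y in nhds 0. f (h y) = s * y ^ n"
    by (rule eventually_mono[OF eventually_nhds_in_open[OF h(2) V0]])
  ultimately show ?L
    unfolding right_equivalent_def by blast
qed

section \<open>Height functions of space curves\<close>

lemma curve_deriv_Suc: "curve_deriv (Suc n) c = (\<lambda>t. vector_derivative (curve_deriv n c) (at t))"
  by (simp add: curve_deriv_def)

lemma curve_deriv_components:
  assumes "open S" "smooth_on S c" "t \<in> S"
  shows "curve_deriv n c t = (\<chi> i. (deriv ^^ n) (\<lambda>t. c t $ i) t)"
  using assms(3)
proof (induction n arbitrary: t)
  case 0
  then show ?case by (simp add: curve_deriv_def vec_eq_iff)
next
  case (Suc n)
  have "((deriv ^^ n) (\<lambda>t. c t $ i) has_vector_derivative (deriv ^^ Suc n) (\<lambda>t. c t $ i) t) (at t)" for i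
    using smooth_on_real_deriv(1)[OF assms(1) smooth_on_funpow_deriv[OF assms(1) smooth_on_nth[OF assms(1,2)]] Suc.prems]
    by (simp add: has_real_derivative_iff_has_vector_derivative)
  then have "((\<lambda>t. \<chi> i. (deriv ^^ n) (\<lambda>t. c t $ i) t) has_vector_derivative
      (\<chi> i. (deriv ^^ Suc n) (\<lambda>t. c t $ i) t)) (at t)"
    unfolding has_vector_derivative_def
    by (subst has_derivative_componentwise_within)
       (auto simp: Basis_vec_def inner_axis)
  then have "(curve_deriv n c has_vector_derivative (\<chi> i. (deriv ^^ Suc n) (\<lambda>t. c t $ i) t)) (at t)"
    by (rule has_vector_derivative_transform_within_open[OF _ assms(1) Suc.prems]) (simp add: Suc.IH)
  then show ?case by (simp add: curve_deriv_Suc vector_derivative_at)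
qed

lemma funpow_deriv_inner:
  assumes "open S" "smooth_on S c" "t \<in> S"
  shows "(deriv ^^ n) (\<lambda>t. c t \<bullet> v) t = curve_deriv n c t \<bullet> v"
  using assms(3)
proof (induction n arbitrary: t)
  case 0
  then show ?case by (simp add: curve_deriv_def)
next
  case (Suc n)
  have "((deriv ^^ n) (\<lambda>t. c t $ i) has_real_derivative (deriv ^^ Suc n) (\<lambda>t. c t $ i) t) (at t)" for i
    using smooth_on_real_deriv(1)[OF assms(1) smooth_on_funpow_deriv[OF assms(1) smooth_on_nth[OF assms(1,2)]] Suc.prems]
    by simp
  then have "((\<lambda>t. \<Sum>i\<in>UNIV. (deriv ^^ n) (\<lambda>t. c t $ i) t * v $ i) has_real_derivative
      (\<Sum>i\<in>UNIV. (deriv ^^ Suc n) (\<lambda>t. c t $ i) t * v $ i)) (at t)"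
    by (intro DERIV_sum DERIV_cmult_right)
  then have "((\<lambda>t. \<Sum>i\<in>UNIV. (deriv ^^ n) (\<lambda>t. c t $ i) t * v $ i) has_real_derivative
      curve_deriv (Suc n) c t \<bullet> v) (at t)"
    by (simp add: curve_deriv_components[OF assms(1,2) Suc.prems] inner_vec_def)
  moreover have "(\<Sum>i\<in>UNIV. (deriv ^^ n) (\<lambda>t. c t $ i) u * v $ i) = (deriv ^^ n) (\<lambda>t. c t \<bullet> v) u"
    if "u \<in> S" for u
    unfolding Suc.IH[OF that] by (simp add: curve_deriv_components[OF assms(1,2) that] inner_vec_def)
  ultimately have "((deriv ^^ n) (\<lambda>t. c t \<bullet> v) has_real_derivative curve_deriv (Suc n) c t \<bullet> v) (at t)"
    by (rule has_field_derivative_transform_within_open[OF _ assms(1) Suc.prems])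
  then show ?case by (simp add: DERIV_imp_deriv)
qed

text \<open>The span of the independent vectors \<open>u\<close>, \<open>w\<close> and the plane orthogonal to \<open>v\<close> both have dimension 2,
  so they agree as soon as one contains the other.\<close>
lemma plane_eq_span_iff:
  fixes u w v :: "real^3"
  assumes "cross3 u w \<noteq> 0" "v \<noteq> 0" "u \<bullet> v = 0"
  shows "{p. p \<bullet> v = 0} = span {u, w} \<longleftrightarrow> w \<bullet> v = 0"
proof
  assume "{p. p \<bullet> v = 0} = span {u, w}"
  moreover have "w \<in> span {u, w}" by (simp add: span_base)
  ultimately show "w \<bullet> v = 0" by blast
next
  assume w: "w \<bullet> v = 0"
  have "w \<noteq> 0" "u \<noteq> w" "u \<notin> span {w}"
    using assms(1) by (auto simp: span_singleton cross_mult_left)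
  then have "independent {u, w}" "u \<noteq> w" by (auto simp: independent_insert)
  then have "dim (span {u, w}) = 2" by (simp add: dim_span dim_eq_card_independent)
  moreover have "dim {p. p \<bullet> v = 0} = 2"
    using dim_hyperplane[OF assms(2)] by (simp add: inner_commute)
  moreover have "span {u, w} \<subseteq> {p. p \<bullet> v = 0}"
    by (rule span_minimal) (use assms w in \<open>auto simp: subspace_hyperplane2\<close>)
  ultimately show "{p. p \<bullet> v = 0} = span {u, w}"
    using subspace_dim_equal[OF subspace_span subspace_hyperplane2, of "{u, w}" v] by auto
qed

text \<open>Both \<open>v\<close> and \<open>u \<times> w\<close> are normal to the plane spanned by \<open>u\<close> and \<open>w\<close>, hence proportional.\<close>
lemma triple_product_eq_0_iff:
  fixes u w v z :: "real^3"
  assumes "cross3 u w \<noteq> 0" "v \<noteq> 0" "u \<bullet> v = 0" "w \<bullet> v = 0"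
  shows "cross3 u w \<bullet> z = 0 \<longleftrightarrow> z \<bullet> v = 0"
proof -
  have "cross3 (cross3 u w) v = (u \<bullet> v) *\<^sub>R w - (w \<bullet> v) *\<^sub>R u"
    by (simp add: cross3_simps forall_3)
  then have "cross3 (cross3 u w) v = 0" using assms by simp
  then obtain k where k: "v = k *\<^sub>R cross3 u w"
    using assms(1,2) by (auto simp: cross_eq_0 collinear_lemma)
  then have "k \<noteq> 0" using assms(2) by auto
  then show ?thesis by (subst k) (simp add: inner_commute)
qed

text \<open>The derivatives of the height function of a space curve are the inner products of \<open>v\<close>
  with the derivatives of the curve. When \<open>v\<close> is normal to the velocity, the second derivative
  vanishes exactly if \<open>v\<close> is normal to the osculating plane, and the third one is then a nonzero
  multiple of the torsion. This holds for any curve through the origin that has nonzero curvature there.\<close>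
lemma
  fixes c :: "real \<Rightarrow> real^3" and v :: "real^3"
  assumes c: "smooth_germ 0 c" "c 0 = 0"
    and frame: "cross3 (curve_deriv 1 c 0) (curve_deriv 2 c 0) \<noteq> 0"
    and v: "v \<noteq> 0" "curve_deriv 1 c 0 \<bullet> v = 0"
  defines "H \<equiv> \<lambda>t. c t \<bullet> v"
  shows height_A1_iff: "A1_plus H \<or> A1_minus H \<longleftrightarrow> orth_plane v \<noteq> osculating_plane c 0"
    and height_A2_iff: "s \<in> {1, -1} \<Longrightarrow> right_equivalent H (\<lambda>x. s * x ^ 3) \<longleftrightarrow>
          orth_plane v = osculating_plane c 0 \<and> torsion c 0 \<noteq> 0"
proof -
  obtain r where r: "r > 0" "smooth_on (ball 0 r) c" using smooth_germ_ball[OF c(1)] .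
  have "smooth_on (ball 0 r) H"
    unfolding H_def
    by (intro smooth_on_bounded_bilinear[OF bounded_bilinear_inner] r smooth_on_const open_ball)
  then have H: "smooth_germ 0 H"
    unfolding smooth_germ_def using r(1) by (intro exI[of _ "ball 0 r"]) simp
  have D: "(deriv ^^ n) H 0 = curve_deriv n c 0 \<bullet> v" for n
    unfolding H_def using funpow_deriv_inner[OF open_ball r(2)] r(1) by simp
  have D01: "(deriv ^^ 0) H 0 = 0" "(deriv ^^ 1) H 0 = 0"
    unfolding D using c(2) v(2) by (simp_all add: curve_deriv_def)
  have osc: "orth_plane v = osculating_plane c 0 \<longleftrightarrow> (deriv ^^ 2) H 0 = 0"
    using plane_eq_span_iff[OF frame v] c(2) D[of 2]
    by (simp add: orth_plane_def osculating_plane_def)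
  have tors: "torsion c 0 \<noteq> 0 \<longleftrightarrow> (deriv ^^ 3) H 0 \<noteq> 0" if "(deriv ^^ 2) H 0 = 0"
    using triple_product_eq_0_iff[OF frame v, of "curve_deriv 3 c 0"] that frame
    by (simp add: D torsion_def)
  \<comment> \<open>For even exponents the sign of the leading derivative matters: it separates the two forms of
    the singularity.\<close>
  have sq: "right_equivalent H (\<lambda>x. s * x ^ 2) \<longleftrightarrow> s * (deriv ^^ 2) H 0 > 0" if "s \<in> {1, -1}" for s
  proof -
    have "(\<exists>c. c \<noteq> 0 \<and> (deriv ^^ 2) H 0 = fact 2 * (s * c ^ 2)) \<longleftrightarrow> s * (deriv ^^ 2) H 0 > 0"
    proof
      assume "s * (deriv ^^ 2) H 0 > 0"
      then show "\<exists>c. c \<noteq> 0 \<and> (deriv ^^ 2) H 0 = fact 2 * (s * c ^ 2)"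
        using that by (intro exI[of _ "sqrt (s * (deriv ^^ 2) H 0 / 2)"]) auto
    qed (use that in auto)
    then show ?thesis
      using that D01 right_equivalent_power_iff[OF H, of s 2] by (auto simp: less_2_cases_iff)
  qed
  show "A1_plus H \<or> A1_minus H \<longleftrightarrow> orth_plane v \<noteq> osculating_plane c 0"
    using sq[of 1] sq[of "-1"] osc by (auto simp: A1_plus_def A1_minus_def)
  show "right_equivalent H (\<lambda>x. s * x ^ 3) \<longleftrightarrow>
          orth_plane v = osculating_plane c 0 \<and> torsion c 0 \<noteq> 0" if "s \<in> {1, -1}"
  proof -
    have "(\<exists>c. c \<noteq> 0 \<and> (deriv ^^ 3) H 0 = fact 3 * (s * c ^ 3)) \<longleftrightarrow> (deriv ^^ 3) H 0 \<noteq> 0"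
    proof
      assume "(deriv ^^ 3) H 0 \<noteq> 0"
      then show "\<exists>c. c \<noteq> 0 \<and> (deriv ^^ 3) H 0 = fact 3 * (s * c ^ 3)"
        using that
        by (intro exI[of _ "root 3 (s * (deriv ^^ 3) H 0 / 6)"])
           (auto simp: odd_real_root_pow fact_numeral)
    qed (use that in auto)
    moreover have "(\<forall>j<3. (deriv ^^ j) H 0 = 0) \<longleftrightarrow> (deriv ^^ 2) H 0 = 0"
      using D01 by (auto simp: numeral_3_eq_3 numeral_2_eq_2 less_Suc_eq)
    ultimately show ?thesis
      using that tors osc right_equivalent_power_iff[OF H, of s 3] by auto
  qed
qed

section \<open>Model submersions and model surfaces\<close>

lemma diffeo_germ_id: "diffeo_germ (\<lambda>x. x) 0 0"
  unfolding diffeo_germ_def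
  by (intro conjI exI[of _ UNIV] exI[of _ "\<lambda>x. x"]) (auto simp: homeomorphism_def smooth_on_ident)

lemma diffeo_germ_global:
  assumes "smooth_on UNIV K" "smooth_on UNIV L" "\<And>x. L (K x) = x" "\<And>x. K (L x) = x" "K 0 = 0"
  shows "diffeo_germ K 0 0"
proof -
  have "C_diff_on 0 UNIV K" "C_diff_on 0 UNIV L" using assms(1,2) unfolding smooth_on_def by blast+
  then have "homeomorphism UNIV UNIV K L"
    using assms(3,4) by (auto simp: homeomorphism_def surj_def) metis+
  then show ?thesis
    unfolding diffeo_germ_def using assms by (intro conjI exI[of _ UNIV] exI[of _ L]) auto
qed

lemma smooth_on_proj: "open S \<Longrightarrow> smooth_on S (\<lambda>p::real^'n. p $ i)"
  by (rule smooth_on_bounded_linear[OF _ bounded_linear_vec_nth])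

lemma submersion_germ_model:
  assumes "k \<ge> 2" shows "submersion_germ 0 (model_submersion s k)"
proof -
  have "smooth_on UNIV (model_submersion s k)"
    unfolding model_submersion_def
    by (intro smooth_on_add smooth_on_mult smooth_on_const smooth_on_power smooth_on_proj open_UNIV)
  then have "smooth_germ 0 (model_submersion s k)"
    by (auto simp: smooth_germ_def)
  moreover have "(model_submersion s k has_derivative (\<lambda>h. h $ 2)) (at 0)"
    unfolding model_submersion_def using assms
    by (auto intro!: derivative_eq_intros bounded_linear_imp_has_derivative bounded_linear_vec_nth simp: power_0_left)
  then have "frechet_derivative (model_submersion s k) (at 0) = (\<lambda>h. h $ 2)"
    using frechet_derivative_at by metis
  moreover have "surj (\<lambda>h::real^3. h $ 2)"
    by (rule surjI[of _ "\<lambda>x. axis 2 x"]) simp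
  ultimately show ?thesis by (simp add: submersion_germ_def)
qed

lemma vec3_eq_iff: "p = q \<longleftrightarrow> p $ 1 = q $ 1 \<and> p $ 2 = q $ 2 \<and> p $ 3 = q $ 3" for p q :: "'a^3"
  by (simp add: vec_eq_iff forall_3)

text \<open>Examples with a prescribed height function: for \<open>b\<^sub>0 = x\<close>, \<open>b\<^sub>1 = 0\<close>, \<open>b\<^sub>2 = 1\<close>, \<open>b\<^sub>3 = 0\<close>, the height along
  the edge in the second coordinate direction is \<open>a\<close>, here a monomial. The surfaces
  \<open>(x, a + y\<^sup>2/2, x + y\<^sup>3)\<close> and \<open>(x, a + y\<^sup>2/2, x\<^sup>2 + 2 x y\<^sup>3 + y\<^sup>6)\<close> are brought to the models by polynomial
  changes of the target alone. These recover \<open>y\<^sup>2\<close> from the first two coordinates, and then remove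
  \<open>x\<close>, respectively \<open>x\<^sup>2 + y\<^sup>6\<close>, from the third.\<close>
lemma folded_cuspidal_edge_monomial:
  assumes "k \<ge> 2"
  shows "folded_cuspidal_edge (\<lambda>x. c * x ^ k) (\<lambda>x. x) (\<lambda>x. 0) (\<lambda>x. 1) (\<lambda>p. 0)"
proof -
  note smooth = smooth_on_vector_3 smooth_on_add smooth_on_diff smooth_on_mult smooth_on_const smooth_on_power
    smooth_on_proj smooth_on_ident open_UNIV
  have germ: "smooth_on UNIV f \<Longrightarrow> smooth_germ 0 f" for f :: "'x::real_normed_vector \<Rightarrow> 'y::real_normed_vector"
    by (auto simp: smooth_germ_def)
  have "deriv (\<lambda>x::real. c * x ^ k) 0 = 0"
    using assms by (intro DERIV_imp_deriv) (auto intro!: derivative_eq_intros simp: power_0_left)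
  moreover have "cuspidal_edge (edge_param (\<lambda>x. c * x ^ k) (\<lambda>x. x) (\<lambda>x. 0) (\<lambda>x. 1) (\<lambda>p. 0))"
  proof -
    define K :: "real^3 \<Rightarrow> real^3" where
      "K p = vector [p $ 1, 2 * (p $ 2 - c * (p $ 1) ^ k), p $ 3 - p $ 1]" for p
    define L :: "real^3 \<Rightarrow> real^3" where
      "L p = vector [p $ 1, 1/2 * p $ 2 + c * (p $ 1) ^ k, p $ 3 + p $ 1]" for p
    have "smooth_on UNIV K" "smooth_on UNIV L" unfolding K_def L_def by (intro smooth)+
    then have "diffeo_germ K 0 0"
      by (rule diffeo_germ_global) (use assms in \<open>auto simp: K_def L_def vec3_eq_iff field_simps\<close>)
    then show ?thesis
      unfolding cuspidal_edge_def A_equivalent_def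
      by (intro exI[of _ "\<lambda>x. x"] exI[of _ K] conjI diffeo_germ_id always_eventually)
         (auto simp: K_def edge_param_def model_cuspidal_edge_def)
  qed
  moreover have "cuspidal_cross_cap (folded_param (\<lambda>x. c * x ^ k) (\<lambda>x. x) (\<lambda>x. 0) (\<lambda>x. 1) (\<lambda>p. 0))"
  proof -
    define K :: "real^3 \<Rightarrow> real^3" where
      "K p = vector [p $ 1, 2 * (p $ 2 - c * (p $ 1) ^ k),
        1/2 * (p $ 3 - (p $ 1)\<^sup>2 - (2 * (p $ 2 - c * (p $ 1) ^ k)) ^ 3)]" for p
    define L :: "real^3 \<Rightarrow> real^3" where
      "L p = vector [p $ 1, 1/2 * p $ 2 + c * (p $ 1) ^ k, 2 * p $ 3 + (p $ 1)\<^sup>2 + (p $ 2) ^ 3]" for p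
    have "smooth_on UNIV K" "smooth_on UNIV L" unfolding K_def L_def by (intro smooth)+
    then have "diffeo_germ K 0 0"
      by (rule diffeo_germ_global) (use assms in \<open>auto simp: K_def L_def vec3_eq_iff field_simps\<close>)
    moreover have "((x + y ^ 3)\<^sup>2 - x\<^sup>2 - (y\<^sup>2) ^ 3) / 2 = x * y ^ 3" for x y :: real
      by (simp add: power2_eq_square power3_eq_cube algebra_simps)
    ultimately show ?thesis
      unfolding cuspidal_cross_cap_def A_equivalent_def
      by (intro exI[of _ "\<lambda>x. x"] exI[of _ K] conjI diffeo_germ_id always_eventually)
         (auto simp: K_def folded_param_def fold_map_def edge_param_def model_cross_cap_def)
  qed
  ultimately show ?thesis
    unfolding folded_cuspidal_edge_def using assms
    by (intro conjI germ smooth) auto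
qed

lemma right_equivalent_refl: "right_equivalent f f"
  unfolding right_equivalent_def using diffeo_germ_id by (intro exI[of _ "\<lambda>x. x"]) simp

section \<open>The edge curve of a folded cuspidal edge\<close>

text \<open>The edge curve is \<open>(x, a, b\<^sub>0\<^sup>2)\<close>. Since \<open>b\<^sub>0\<close> vanishes at the origin, the first derivative of its square
  vanishes there and the second one is \<open>2 b\<^sub>0'(0)\<^sup>2\<close>; this being nonzero is what gives the curve nonzero curvature.\<close>
lemma edge_curve_second_order:
  assumes "folded_cuspidal_edge a b0 b1 b2 b3"
  defines "c \<equiv> \<lambda>x. folded_param a b0 b1 b2 b3 (x, 0)"
  shows "smooth_germ 0 c" "c 0 = 0" "curve_deriv 1 c 0 = axis 1 1"
    "curve_deriv 2 c 0 = vector [0, (deriv ^^ 2) a 0, 2 * (deriv b0 0)\<^sup>2]"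
proof -
  have c: "c = (\<lambda>x. vector [x, a x, (b0 x)\<^sup>2])"
    by (simp add: c_def folded_param_def fold_map_def edge_param_def fun_eq_iff)
  from assms(1) have "smooth_germ 0 a" "smooth_germ 0 b0" and a0: "a 0 = 0" "deriv a 0 = 0" "b0 0 = 0"
    by (auto simp: folded_cuspidal_edge_def)
  then obtain r1 r2 where r12: "r1 > 0" "smooth_on (ball 0 r1) a" "r2 > 0" "smooth_on (ball 0 r2) b0"
    by (metis smooth_germ_ball)
  define S where "S = ball (0::real) (min r1 r2)"
  have S: "open S" "0 \<in> S" and a: "smooth_on S a" and b: "smooth_on S b0"
    using r12 by (auto simp: S_def intro: smooth_on_subset)
  have c_smooth: "smooth_on S c"
    unfolding c by (intro smooth_on_vector_3 smooth_on_ident smooth_on_power S a b)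
  then show "smooth_germ 0 c" unfolding smooth_germ_def using S by blast
  show "c 0 = 0" using a0 by (simp add: c vec3_eq_iff)
  have db: "deriv (\<lambda>x. (b0 x)\<^sup>2) x = 2 * b0 x * deriv b0 x" if "x \<in> S" for x
    by (rule DERIV_imp_deriv)
       (use smooth_on_real_deriv(1)[OF S(1) b that] in \<open>auto intro!: derivative_eq_intros\<close>)
  have "((\<lambda>x. 2 * b0 x * deriv b0 x) has_real_derivative 2 * (deriv b0 0)\<^sup>2) (at 0)"
    using smooth_on_real_deriv(1)[OF S(1) b S(2)] a0
      smooth_on_real_deriv(1)[OF S(1) smooth_on_real_deriv(2)[OF S(1) b] S(2)]
    by (auto intro!: derivative_eq_intros simp: power2_eq_square)
  then have ddb: "deriv (deriv (\<lambda>x. (b0 x)\<^sup>2)) 0 = 2 * (deriv b0 0)\<^sup>2"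
    by (intro DERIV_imp_deriv, elim has_field_derivative_transform_within_open[OF _ S]) (simp add: db)
  have C: "curve_deriv n c 0 =
      vector [(deriv ^^ n) (\<lambda>x. x) 0, (deriv ^^ n) a 0, (deriv ^^ n) (\<lambda>x. (b0 x)\<^sup>2) 0]" for n
    unfolding curve_deriv_components[OF S(1) c_smooth S(2)] by (simp add: vec3_eq_iff c)
  show "curve_deriv 1 c 0 = axis 1 1"
    unfolding C using a0 db[OF S(2)] by (simp add: vec3_eq_iff axis_def)
  show "curve_deriv 2 c 0 = vector [0, (deriv ^^ 2) a 0, 2 * (deriv b0 0)\<^sup>2]"
    unfolding C using ddb by (simp add: numeral_2_eq_2)
qed

theorem proposition3p8:
  fixes a b0 b1 b2 :: "real \<Rightarrow> real" and b3 :: "real \<times> real \<Rightarrow> real"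
    and \<phi> :: "real \<times> real \<Rightarrow> real^3" and \<Sigma> :: "real \<Rightarrow> real^3"
    and v :: "real^3" and Hv :: "real \<Rightarrow> real"
  assumes "folded_cuspidal_edge a b0 b1 b2 b3"
    and "\<phi> = folded_param a b0 b1 b2 b3"
    and "\<Sigma> = (\<lambda>x. \<phi> (x, 0))"
    and "norm v = 1" and "v $ 1 = 0"
    and "Hv = (\<lambda>x. height \<phi> v (x, 0))"
  shows
    "(A1_plus Hv \<or> A1_minus Hv \<longleftrightarrow> orth_plane v \<noteq> osculating_plane \<Sigma> 0) \<and>
     (A2 Hv \<longleftrightarrow> orth_plane v = osculating_plane \<Sigma> 0 \<and> torsion \<Sigma> 0 \<noteq> 0) \<and>
     (\<forall>s\<in>{1, -1}. \<forall>k\<in>{2, 3}. submersion_germ 0 (model_submersion s k)) \<and>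
     (A1_plus Hv \<longleftrightarrow> right_equivalent Hv (\<lambda>x. model_submersion 1 2 (model_cross_cap (x, 0)))) \<and>
     (A1_minus Hv \<longleftrightarrow> right_equivalent Hv (\<lambda>x. model_submersion (-1) 2 (model_cross_cap (x, 0)))) \<and>
     (\<forall>s\<in>{1, -1}.
       A2 Hv \<longleftrightarrow> right_equivalent Hv (\<lambda>x. model_submersion s 3 (model_cross_cap (x, 0)))) \<and>
     (\<forall>sing\<in>{A1_plus, A1_minus, A2}. \<exists>a' b0' b1' b2' b3' v'.
       folded_cuspidal_edge a' b0' b1' b2' b3' \<and> norm v' = 1 \<and> v' $ 1 = 0 \<and>
       sing (\<lambda>x. height (folded_param a' b0' b1' b2' b3') v' (x, 0)))"
proof -
  have \<Sigma>: "\<Sigma> = (\<lambda>x. folded_param a b0 b1 b2 b3 (x, 0))" and Hv: "Hv = (\<lambda>x. \<Sigma> x \<bullet> v)"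
    using assms(2,3,6) by (simp_all add: height_def)
  note \<Sigma>_derivs = edge_curve_second_order[OF assms(1), folded \<Sigma>]
  have "deriv b0 0 \<noteq> 0" using assms(1) by (auto simp: folded_cuspidal_edge_def)
  then have frame: "cross3 (curve_deriv 1 \<Sigma> 0) (curve_deriv 2 \<Sigma> 0) \<noteq> 0"
    unfolding \<Sigma>_derivs(3,4) by (simp add: cross3_def vec3_eq_iff axis_def)
  have v: "v \<noteq> 0" "curve_deriv 1 \<Sigma> 0 \<bullet> v = 0"
    unfolding \<Sigma>_derivs(3) using assms(4,5) by (auto simp: inner_axis')
  have \<Sigma>0: "\<Sigma> 0 = 0" using \<Sigma>_derivs(2) by (simp add: \<Sigma>)
  note A1 = height_A1_iff[OF \<Sigma>_derivs(1) \<Sigma>0 frame v, folded Hv]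
    and A2 = height_A2_iff[OF \<Sigma>_derivs(1) \<Sigma>0 frame v, folded Hv]
  have model: "model_submersion s k (model_cross_cap (x, 0)) = s * x ^ k" for s k x
    by (simp add: model_submersion_def model_cross_cap_def)
  have example: "\<exists>a' b0' b1' b2' b3' v'. folded_cuspidal_edge a' b0' b1' b2' b3' \<and> norm v' = 1 \<and> v' $ 1 = 0 \<and>
       sing (\<lambda>x. height (folded_param a' b0' b1' b2' b3') v' (x, 0))"
    if "k \<ge> 2" "sing (\<lambda>x. c * x ^ k)" for k c and sing :: "(real \<Rightarrow> real) \<Rightarrow> bool"
  proof -
    have "(\<lambda>x. height (folded_param (\<lambda>x. c * x ^ k) (\<lambda>x. x) (\<lambda>x. 0) (\<lambda>x. 1) (\<lambda>p. 0)) (axis 2 1) (x, 0))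
        = (\<lambda>x. c * x ^ k)"
      by (simp add: height_def folded_param_def fold_map_def edge_param_def inner_axis)
    moreover have "(axis 2 1 :: real^3) $ 1 = 0" by (simp add: axis_def)
    ultimately show ?thesis
      using folded_cuspidal_edge_monomial[OF that(1), of c] that(2)
      by (intro exI[of _ "\<lambda>x. c * x ^ k"] exI[of _ "\<lambda>x. x"] exI[of _ "\<lambda>x. 0"] exI[of _ "\<lambda>x. 1"]
          exI[of _ "\<lambda>p. 0"] exI[of _ "axis 2 1"]) (simp add: norm_axis_1)
  qed
  have "\<exists>a' b0' b1' b2' b3' v'. folded_cuspidal_edge a' b0' b1' b2' b3' \<and> norm v' = 1 \<and> v' $ 1 = 0 \<and>
       sing (\<lambda>x. height (folded_param a' b0' b1' b2' b3') v' (x, 0))"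
    if "sing \<in> {A1_plus, A1_minus, A2}" for sing
  proof -
    have "sing (\<lambda>x. 1 * x ^ 2) \<or> sing (\<lambda>x. (-1) * x ^ 2) \<or> sing (\<lambda>x. 1 * x ^ 3)"
      using that right_equivalent_refl by (auto simp: A1_plus_def A1_minus_def A2_def)
    then show ?thesis
      by (elim disjE) (rule example[rotated], assumption, simp)+
  qed
  moreover have "A2 Hv \<longleftrightarrow> right_equivalent Hv (\<lambda>x. s * x ^ 3)" if "s \<in> {1, -1}" for s
    using A2[OF that] A2[of 1] by (simp add: A2_def)
  moreover have "A2 Hv \<longleftrightarrow> orth_plane v = osculating_plane \<Sigma> 0 \<and> torsion \<Sigma> 0 \<noteq> 0"
    using A2[of 1] by (simp add: A2_def)
  ultimately show ?thesis
    using A1 submersion_germ_model by (simp add: model A1_plus_def A1_minus_def)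
qed

end
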